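(* Let $\varepsilon>0$ and suppose that $(u^n,\xi^n)$ is an admissible single-interface state. Then one iteration step $(u^n,\xi^n)\rightsquigarrow(u^{n+1},\xi^{n+1})$ of the scheme is well-defined (that is, $\tilde u^n=g_\varepsilon\ast u^n$ exists and the update rule determines a unique $\xi^{n+1}\in\mathbb{R}$), and $(u^{n+1},\xi^{n+1})$ fulfills the refined single-interface property $$-2\le u^{n+1}(x)\le 0\quad\text{for } x\le \xi^{n+1},\qquad u^{n+1}(x)\ge 0\quad\text{for } x>\xi^{n+1}.$$
   Context: Kernels: for $\varepsilon>0$ let $g_\varepsilon(x)=\frac{1}{2\varepsilon}\exp(-|x|/\varepsilon)$, and let $s_\varepsilon(x)=-\exp(x/\varepsilon)$ for $x\le0$, $s_\varepsilon(x)=+\exp(-x/\varepsilon)$ for $x>0$ (so $s_\varepsilon=\mathrm{sgn}-g_\varepsilon\ast\mathrm{sgn}$). Iteration step of the scheme: given $(u^n,\xi^n)$ with $u^n:\mathbb{R}\to\mathbb{R}$, $\xi^n\in\mathbb{R}$: 1. Set $\tilde u^n:=g_\varepsilon\ast u^n$. 2. Update of $\xi^n$: (LM) if $\tilde u^n(\xi^n)>1$, choose the maximal value of $\xi^{n+1}$ with $\xi^{n+1}<\xi^n$ and $\tilde u^n(\xi^{n+1})=+1$; (RM) if $\tilde u^n(\xi^n)<-1$, choose the minimal value of $\xi^{n+1}$ with $\xi^{n+1}>\xi^n$ and $\tilde u^n(\xi^{n+1})=-1$; (ST) if $\tilde u^n(\xi^n)\in[-1,1]$, set $\xi^{n+1}=\xi^n$.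 3. Set $u^{n+1}=\tilde u^n+s_\varepsilon(\cdot-\xi^{n+1})$. Admissible single-interface state: a pair $(u^n,\xi^n)$ such that (i) $u^n$ is continuous for $x<\xi^n$ and for $x>\xi^n$; (ii) the jump $\lim_{x\searrow\xi^n}u^n(x)-\lim_{x\nearrow\xi^n}u^n(x)$ equals $2$; (iii) (refined single-interface property) $-2\le u^n(x)\le0$ for $x\le\xi^n$ and $u^n(x)\ge0$ for $x>\xi^n$; (iv) (majorant property) there exists $\alpha>0$ such that $u^n(x)\le\alpha(x-\xi^n)+2$ for all $x>\xi^n$. *)

theory Defs
  imports "HOL-Analysis.Analysis"
begin

definition convolution_exists :: "(real \<Rightarrow> real) \<Rightarrow> (real \<Rightarrow> real) \<Rightarrow> bool" where
  "convolution_exists f h \<longleftrightarrow> (\<forall>x. integrable lborel (\<lambda>y. f (x - y) * h y))"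

definition convolution :: "(real \<Rightarrow> real) \<Rightarrow> (real \<Rightarrow> real) \<Rightarrow> real \<Rightarrow> real" where
  "convolution f h x = (LINT y|lborel. f (x - y) * h y)"

definition g_kernel :: "real \<Rightarrow> real \<Rightarrow> real" where
  "g_kernel \<epsilon> x = 1 / (2 * \<epsilon>) * exp (- \<bar>x\<bar> / \<epsilon>)"

definition s_kernel :: "real \<Rightarrow> real \<Rightarrow> real" where
  "s_kernel \<epsilon> x = (if x \<le> 0 then - exp (x / \<epsilon>) else exp (- x / \<epsilon>))"

definition smoothed :: "real \<Rightarrow> (real \<Rightarrow> real) \<Rightarrow> real \<Rightarrow> real" where
  "smoothed \<epsilon> u = convolution (g_kernel \<epsilon>) u"

text \<open>The three implications are the left-moving, right-moving and standing update of the
  interface position; their premises are exhaustive and mutually exclusive.\<close>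

definition interface_update ::
    "real \<Rightarrow> (real \<Rightarrow> real) \<Rightarrow> real \<Rightarrow> real \<Rightarrow> bool" where
  "interface_update \<epsilon> u \<xi> \<xi>' \<longleftrightarrow>
     (smoothed \<epsilon> u \<xi> > 1 \<longrightarrow>
        \<xi>' < \<xi> \<and> smoothed \<epsilon> u \<xi>' = 1 \<and>
        (\<forall>z. z < \<xi> \<and> smoothed \<epsilon> u z = 1 \<longrightarrow> z \<le> \<xi>')) \<and>
     (smoothed \<epsilon> u \<xi> < - 1 \<longrightarrow>
        \<xi>' > \<xi> \<and> smoothed \<epsilon> u \<xi>' = - 1 \<and>
        (\<forall>z. z > \<xi> \<and> smoothed \<epsilon> u z = - 1 \<longrightarrow> \<xi>' \<le> z)) \<and>
     (smoothed \<epsilon> u \<xi> \<in> {- 1..1} \<longrightarrow> \<xi>' = \<xi>)"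

definition iteration_step ::
    "real \<Rightarrow> (real \<Rightarrow> real) \<times> real \<Rightarrow> (real \<Rightarrow> real) \<times> real \<Rightarrow> bool" where
  "iteration_step \<epsilon> = (\<lambda>(u, \<xi>) (u', \<xi>').
     interface_update \<epsilon> u \<xi> \<xi>' \<and>
     u' = (\<lambda>x. smoothed \<epsilon> u x + s_kernel \<epsilon> (x - \<xi>')))"

definition refined_single_interface :: "(real \<Rightarrow> real) \<Rightarrow> real \<Rightarrow> bool" where
  "refined_single_interface u \<xi> \<longleftrightarrow>
     (\<forall>x\<le>\<xi>. - 2 \<le> u x \<and> u x \<le> 0) \<and> (\<forall>x>\<xi>. u x \<ge> 0)"

definition jump_eq :: "(real \<Rightarrow> real) \<Rightarrow> real \<Rightarrow> real \<Rightarrow> bool" where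
  "jump_eq u \<xi> d \<longleftrightarrow>
     (\<exists>l r. (u \<longlongrightarrow> l) (at_left \<xi>) \<and> (u \<longlongrightarrow> r) (at_right \<xi>) \<and> r - l = d)"

definition majorant_property :: "(real \<Rightarrow> real) \<Rightarrow> real \<Rightarrow> bool" where
  "majorant_property u \<xi> \<longleftrightarrow> (\<exists>\<alpha>>0. \<forall>x>\<xi>. u x \<le> \<alpha> * (x - \<xi>) + 2)"

definition admissible_state :: "(real \<Rightarrow> real) \<Rightarrow> real \<Rightarrow> bool" where
  "admissible_state u \<xi> \<longleftrightarrow>
     continuous_on {..<\<xi>} u \<and> continuous_on {\<xi><..} u \<and>
     jump_eq u \<xi> 2 \<and>
     refined_single_interface u \<xi> \<and>
     majorant_property u \<xi>"

end

theory Submission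
  imports Defs
begin

text \<open>The triangle inequality gives the Harnack bound
  \<open>g(x - y) \<ge> exp(-\<bar>x - z\<bar>/\<epsilon>) g(z - y)\<close>, with equality when \<open>z\<close> lies between \<open>x\<close> and \<open>y\<close>.
  Since \<open>u\<close> changes sign exactly at \<open>\<xi>\<close>, the smoothed profile \<open>v\<close> satisfies
  \<open>v(x) \<le> exp(-\<bar>x - z\<bar>/\<epsilon>) v(z)\<close> for \<open>x \<le> z \<le> \<xi>\<close> and the reverse inequality for
  \<open>\<xi> \<le> z \<le> x\<close>; up to sign, the exponential is the value of \<open>s\<close> at \<open>x - z\<close>.
  The bound \<open>u \<ge> -2\<close> left of the interface forces
  a smoothed value of at least \<open>-1\<close> at \<open>\<xi>\<close>, so the interface never moves to the right. If it moves
  to the left, the decay provides a crossing of the level 1, and the lower bound \<open>-2\<close> for the new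
  state survives because the crossing at \<open>\<xi>'\<close> requires the positive part of \<open>u\<close> to contribute at
  least \<open>exp((\<xi> - \<xi>')/\<epsilon>)\<close> at \<open>\<xi>\<close>.\<close>

section \<open>Pointwise comparison of shifted kernels\<close>

lemma g_kernel_nonneg: "\<epsilon> > 0 \<Longrightarrow> g_kernel \<epsilon> x \<ge> 0"
  by (simp add: g_kernel_def)

lemma g_kernel_measurable [measurable]: "g_kernel \<epsilon> \<in> borel_measurable borel"
  unfolding g_kernel_def by measurable

lemma g_kernel_shift_le:
  assumes "\<epsilon> > 0"
  shows "exp (- \<bar>x - z\<bar> / \<epsilon>) * g_kernel \<epsilon> (z - y) \<le> g_kernel \<epsilon> (x - y)"
proof -
  have "- \<bar>x - z\<bar> / \<epsilon> + - \<bar>z - y\<bar> / \<epsilon> = (- \<bar>x - z\<bar> - \<bar>z - y\<bar>) / \<epsilon>"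
    by (simp add: diff_divide_distrib)
  also have "\<dots> \<le> - \<bar>x - y\<bar> / \<epsilon>"
    using assms by (intro divide_right_mono) auto
  finally show ?thesis
    using assms by (simp add: g_kernel_def exp_add[symmetric] divide_right_mono)
qed

lemma g_kernel_shift_eq:
  assumes "x \<le> z \<and> z \<le> y \<or> y \<le> z \<and> z \<le> x"
  shows "g_kernel \<epsilon> (x - y) = exp (- \<bar>x - z\<bar> / \<epsilon>) * g_kernel \<epsilon> (z - y)"
proof -
  have "\<bar>x - y\<bar> = \<bar>x - z\<bar> + \<bar>z - y\<bar>"
    using assms by auto
  then show ?thesis
    by (simp add: g_kernel_def exp_add[symmetric] diff_divide_distrib)
qed

text \<open>The Harnack bound, used in both directions, confines the ratio of the two kernels to
  [exp(-d), exp d] with d = |x - z|/\<epsilon>. The deviation downwards is the smaller one, as 1 -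
  exp(-d) \<le> exp d - 1. Keeping the kernel at \<open>z\<close> as a factor makes the bound
  integrable against an unbounded profile.\<close>

lemma g_kernel_diff_le:
  assumes "\<epsilon> > 0"
  shows "\<bar>g_kernel \<epsilon> (x - y) - g_kernel \<epsilon> (z - y)\<bar>
    \<le> (exp (\<bar>x - z\<bar> / \<epsilon>) - 1) * g_kernel \<epsilon> (z - y)"
proof -
  define d where "d = \<bar>x - z\<bar> / \<epsilon>"
  have dz: "\<bar>z - x\<bar> / \<epsilon> = d" by (simp add: d_def abs_minus_commute)
  have lo: "exp (- d) * g_kernel \<epsilon> (z - y) \<le> g_kernel \<epsilon> (x - y)"
    using g_kernel_shift_le[OF assms, of x z y] by (simp add: d_def)
  have "exp (- d) * g_kernel \<epsilon> (x - y) \<le> g_kernel \<epsilon> (z - y)"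
    using g_kernel_shift_le[OF assms, of z x y] by (simp add: dz[symmetric])
  then have hi: "g_kernel \<epsilon> (x - y) \<le> exp d * g_kernel \<epsilon> (z - y)"
    by (simp add: exp_minus field_simps)
  have "2 \<le> exp d + exp (- d)"
    using exp_ge_add_one_self[of d] exp_ge_add_one_self[of "- d"] by linarith
  then have "2 * g_kernel \<epsilon> (z - y) \<le> (exp d + exp (- d)) * g_kernel \<epsilon> (z - y)"
    using g_kernel_nonneg[OF assms] by (intro mult_right_mono)
  with lo hi show ?thesis
    unfolding d_def[symmetric] by (simp add: algebra_simps abs_le_iff)
qed

section \<open>Kernel integrals over half-lines\<close>

lemma has_bochner_integral_g_kernel_atLeast:
  assumes "\<epsilon> > 0" "x \<le> c"
  shows "has_bochner_integral lborel (\<lambda>y. g_kernel \<epsilon> (x - y) * indicator {c..} y)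
           (exp ((x - c) / \<epsilon>) / 2)"
proof (rule has_bochner_integral_nn_integral)
  \<comment> \<open>For y \<ge> c \<ge> x the absolute value resolves to y - x, so \<open>?F\<close>
    is an antiderivative of the kernel, with limit 0 at infinity.\<close>
  let ?F = "\<lambda>y. - exp ((x - y) / \<epsilon>) / 2"
  have "((\<lambda>y. exp ((x - y) / \<epsilon>)) \<longlongrightarrow> 0) at_top"
  proof (rule filterlim_compose[OF exp_at_bot])
    show "filterlim (\<lambda>y. (x - y) / \<epsilon>) at_bot at_top"
      unfolding filterlim_at_bot eventually_at_top_linorder
    proof
      fix Z
      show "\<exists>N. \<forall>y\<ge>N. (x - y) / \<epsilon> \<le> Z"
        using assms by (intro exI[of _ "x - Z * \<epsilon>"]) (simp add: divide_le_eq)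
    qed
  qed
  then have lim: "(?F \<longlongrightarrow> 0) at_top"
    using tendsto_mult_left[of _ 0 at_top "- 1 / 2"] by force
  have "(\<integral>\<^sup>+y. ennreal (exp ((x - y) / \<epsilon>) / (2 * \<epsilon>)) * indicator {c..} y \<partial>lborel)
      = ennreal (0 - ?F c)"
    using assms lim
    by (intro nn_integral_FTC_atLeast) (auto intro!: derivative_eq_intros)
  also have "(\<integral>\<^sup>+y. ennreal (exp ((x - y) / \<epsilon>) / (2 * \<epsilon>)) * indicator {c..} y \<partial>lborel)
      = (\<integral>\<^sup>+y. ennreal (g_kernel \<epsilon> (x - y) * indicator {c..} y) \<partial>lborel)"
    using assms by (intro nn_integral_cong) (auto simp: g_kernel_def indicator_def diff_divide_distrib)
  finally show "(\<integral>\<^sup>+y. ennreal (g_kernel \<epsilon> (x - y) * indicator {c..} y) \<partial>lborel)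
      = ennreal (exp ((x - c) / \<epsilon>) / 2)" by simp
qed (use assms in \<open>auto simp: g_kernel_nonneg\<close>)

lemma has_bochner_integral_g_kernel_atMost:
  assumes "\<epsilon> > 0" "c \<le> x"
  shows "has_bochner_integral lborel (\<lambda>y. g_kernel \<epsilon> (x - y) * indicator {..c} y)
           (exp ((c - x) / \<epsilon>) / 2)"
proof -
  \<comment> \<open>The reflection of y to -y turns this half-line into the one already
    treated.\<close>
  have "has_bochner_integral lborel
      (\<lambda>y. g_kernel \<epsilon> (- x - (0 + (- 1) * y)) * indicator {- c..} (0 + (- 1) * y))
      (exp ((- x - - c) / \<epsilon>) / 2 /\<^sub>R \<bar>- 1\<bar>)"
    using assms
    by (intro lborel_has_bochner_integral_real_affine_iff[THEN iffD1]
        has_bochner_integral_g_kernel_atLeast) auto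
  moreover have "g_kernel \<epsilon> (- x - (0 + (- 1) * y)) * indicator {- c..} (0 + (- 1) * y)
      = g_kernel \<epsilon> (x - y) * indicator {..c} y" for y
    by (auto simp: g_kernel_def indicator_def abs_minus_commute)
  ultimately show ?thesis by simp
qed

lemma has_bochner_integral_g_kernel_greaterThan:
  assumes "\<epsilon> > 0" "x \<le> c"
  shows "has_bochner_integral lborel (\<lambda>y. g_kernel \<epsilon> (x - y) * indicator {c<..} y)
           (exp ((x - c) / \<epsilon>) / 2)"
proof (rule has_bochner_integral_cong_AE[THEN iffD1, rotated 3])
  show "has_bochner_integral lborel (\<lambda>y. g_kernel \<epsilon> (x - y) * indicator {c..} y)
           (exp ((x - c) / \<epsilon>) / 2)"
    using assms by (rule has_bochner_integral_g_kernel_atLeast)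
  show "AE y in lborel. g_kernel \<epsilon> (x - y) * indicator {c..} y
      = g_kernel \<epsilon> (x - y) * indicator {c<..} y"
    using AE_lborel_singleton[of c] by eventually_elim (auto simp: indicator_def)
qed auto

lemma has_bochner_integral_g_kernel:
  assumes "\<epsilon> > 0"
  shows "has_bochner_integral lborel (\<lambda>y. g_kernel \<epsilon> (x - y)) 1"
proof -
  have "has_bochner_integral lborel
     (\<lambda>y. g_kernel \<epsilon> (x - y) * indicator {..x} y + g_kernel \<epsilon> (x - y) * indicator {x<..} y)
     (exp ((x - x) / \<epsilon>) / 2 + exp ((x - x) / \<epsilon>) / 2)"
    using assms by (intro has_bochner_integral_add has_bochner_integral_g_kernel_atMost
        has_bochner_integral_g_kernel_greaterThan) auto
  moreover have "g_kernel \<epsilon> (x - y) * indicator {..x} y + g_kernel \<epsilon> (x - y) * indicator {x<..} y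
      = g_kernel \<epsilon> (x - y)" for y
    by (simp add: indicator_def)
  ultimately show ?thesis by simp
qed

text \<open>The kink of the kernel, at \<open>x\<close>, lies inside this half-line, so the value is
  the total mass 1 minus the tail beyond \<open>c\<close>.\<close>

lemma has_bochner_integral_g_kernel_atMost':
  assumes "\<epsilon> > 0" "x \<le> c"
  shows "has_bochner_integral lborel (\<lambda>y. g_kernel \<epsilon> (x - y) * indicator {..c} y)
           (1 - exp ((x - c) / \<epsilon>) / 2)"
proof -
  have "has_bochner_integral lborel
     (\<lambda>y. g_kernel \<epsilon> (x - y) - g_kernel \<epsilon> (x - y) * indicator {c<..} y)
     (1 - exp ((x - c) / \<epsilon>) / 2)"
    using assms by (intro has_bochner_integral_diff has_bochner_integral_g_kernel
        has_bochner_integral_g_kernel_greaterThan)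
  moreover have "g_kernel \<epsilon> (x - y) - g_kernel \<epsilon> (x - y) * indicator {c<..} y
      = g_kernel \<epsilon> (x - y) * indicator {..c} y" for y
    by (simp add: indicator_def)
  ultimately show ?thesis by simp
qed

section \<open>Existence and continuity of the smoothed profile\<close>

lemma convolution_exists_g_kernel_linear_growth:
  fixes u :: "real \<Rightarrow> real"
  assumes eps: "\<epsilon> > 0" and [measurable]: "u \<in> borel_measurable borel"
    and "A \<ge> 0" "B \<ge> 0" and growth: "\<And>y. \<bar>u y\<bar> \<le> A * \<bar>y - \<xi>\<bar> + B"
  shows "convolution_exists (g_kernel \<epsilon>) u"
  unfolding convolution_exists_def
proof
  fix x
  \<comment> \<open>Doubling the width halves the decay rate: the kernel of width \<epsilon> is
    twice the kernel of width \<open>d\<close> times exp(-t), where t = |x - y|/d. The spare factor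
    exp(-t) absorbs the linear growth, since 1 and t are both at most exp t; \<open>C\<close>
    collects the coefficients.\<close>
  define d where "d = 2 * \<epsilon>"
  have d: "d > 0" using eps by (simp add: d_def)
  define C where "C = A * d + A * \<bar>x - \<xi>\<bar> + B"
  have "integrable lborel (\<lambda>y. 2 * C * g_kernel d (x - y))"
    using has_bochner_integral_g_kernel[OF d, of x] by (auto simp: has_bochner_integral_iff)
  moreover have "\<bar>g_kernel \<epsilon> (x - y) * u y\<bar> \<le> 2 * C * g_kernel d (x - y)" for y
  proof -
    define t where "t = \<bar>x - y\<bar> / d"
    have t: "t \<ge> 0" "\<bar>x - y\<bar> = d * t" using d by (auto simp: t_def)
    have e: "1 \<le> exp t" "t \<le> exp t"
      using t exp_ge_add_one_self[of t] by linarith+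
    have "\<bar>u y\<bar> \<le> A * (\<bar>x - y\<bar> + \<bar>x - \<xi>\<bar>) + B"
      using growth[of y] mult_left_mono[of "\<bar>y - \<xi>\<bar>" "\<bar>x - y\<bar> + \<bar>x - \<xi>\<bar>" A] \<open>A \<ge> 0\<close> by linarith
    also have "\<dots> = (A * d) * t + (A * \<bar>x - \<xi>\<bar> + B) * 1"
      by (simp add: t algebra_simps)
    also have "\<dots> \<le> (A * d) * exp t + (A * \<bar>x - \<xi>\<bar> + B) * exp t"
      using e d \<open>A \<ge> 0\<close> \<open>B \<ge> 0\<close> by (intro add_mono mult_left_mono) auto
    finally have u: "\<bar>u y\<bar> \<le> C * exp t"
      by (simp add: C_def algebra_simps)
    have "g_kernel \<epsilon> (x - y) = 2 * g_kernel d (x - y) * exp (- t)"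
      using eps by (simp add: g_kernel_def t_def d_def exp_add[symmetric] field_simps)
    then have "\<bar>g_kernel \<epsilon> (x - y) * u y\<bar> \<le> 2 * g_kernel d (x - y) * exp (- t) * (C * exp t)"
      using u g_kernel_nonneg[OF d, of "x - y"]
      by (simp add: abs_mult mult_left_mono)
    also have "\<dots> = 2 * C * g_kernel d (x - y)"
      by (simp add: exp_minus)
    finally show ?thesis .
  qed
  ultimately show "integrable lborel (\<lambda>y. g_kernel \<epsilon> (x - y) * u y)"
    by (elim Bochner_Integration.integrable_bound) (auto intro!: AE_I2 intro: order.trans[OF _ abs_ge_self])
qed

text \<open>Integrating the kernel difference bound against the absolute value of \<open>u\<close>
  bounds the increment by exp(|x - z|/\<epsilon>) - 1 times a finite constant, and this vanishes as
  x tends to z.\<close>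

lemma isCont_smoothed:
  assumes eps: "\<epsilon> > 0" and ex: "convolution_exists (g_kernel \<epsilon>) u"
  shows "isCont (smoothed \<epsilon> u) z"
proof -
  have int: "integrable lborel (\<lambda>y. g_kernel \<epsilon> (x - y) * u y)" for x
    using ex by (simp add: convolution_exists_def)
  define K where "K = (LINT y|lborel. \<bar>g_kernel \<epsilon> (z - y) * u y\<bar>)"
  have bound: "\<bar>smoothed \<epsilon> u x - smoothed \<epsilon> u z\<bar> \<le> (exp (\<bar>x - z\<bar> / \<epsilon>) - 1) * K" for x
  proof -
    have "smoothed \<epsilon> u x - smoothed \<epsilon> u z
        = (LINT y|lborel. g_kernel \<epsilon> (x - y) * u y - g_kernel \<epsilon> (z - y) * u y)"
      by (simp add: smoothed_def convolution_def int)
    also have "\<bar>\<dots>\<bar> \<le> (LINT y|lborel. \<bar>g_kernel \<epsilon> (x - y) * u y - g_kernel \<epsilon> (z - y) * u y\<bar>)"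
      by (rule integral_abs_bound)
    also have "\<dots> \<le> (LINT y|lborel. (exp (\<bar>x - z\<bar> / \<epsilon>) - 1) * \<bar>g_kernel \<epsilon> (z - y) * u y\<bar>)"
    proof (rule integral_mono)
      fix y
      show "\<bar>g_kernel \<epsilon> (x - y) * u y - g_kernel \<epsilon> (z - y) * u y\<bar>
          \<le> (exp (\<bar>x - z\<bar> / \<epsilon>) - 1) * \<bar>g_kernel \<epsilon> (z - y) * u y\<bar>"
        using mult_right_mono[OF g_kernel_diff_le[OF eps, of x y z], of "\<bar>u y\<bar>"]
          g_kernel_nonneg[OF eps, of "z - y"]
        by (simp add: abs_mult[symmetric] left_diff_distrib) (simp add: abs_mult mult_ac)
    qed (use int in auto)
    finally show ?thesis by (simp add: K_def)
  qed
  have "((\<lambda>x. smoothed \<epsilon> u x - smoothed \<epsilon> u z) \<longlongrightarrow> 0) (at z)"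
  proof (rule Lim_null_comparison)
    show "\<forall>\<^sub>F x in at z. norm (smoothed \<epsilon> u x - smoothed \<epsilon> u z) \<le> (exp (\<bar>x - z\<bar> / \<epsilon>) - 1) * K"
      using bound by simp
    show "((\<lambda>x. (exp (\<bar>x - z\<bar> / \<epsilon>) - 1) * K) \<longlongrightarrow> 0) (at z)"
      using eps by (auto intro!: tendsto_eq_intros)
  qed
  then show ?thesis
    by (simp add: isCont_def LIM_zero_iff)
qed

lemma borel_measurable_continuous_off_point:
  fixes u :: "real \<Rightarrow> real"
  assumes "continuous_on {..<\<xi>} u" "continuous_on {\<xi><..} u"
  shows "u \<in> borel_measurable borel"
proof -
  \<comment> \<open>Continuity is known on the two open half-lines only, so the value at the
    interface is split off as a multiple of a point indicator.\<close>
  have "u = (\<lambda>y. indicator {..<\<xi>} y *\<^sub>R u y + indicator {\<xi><..} y *\<^sub>R u y + u \<xi> * indicator {\<xi>} y)"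
    by (auto simp: fun_eq_iff indicator_def)
  also have "\<dots> \<in> borel_measurable borel"
    using assms by (intro borel_measurable_add borel_measurable_continuous_on_indicator) auto
  finally show ?thesis .
qed

text \<open>The bounds -2 and 0 on the left and the bounds 0 and the majorant on the right combine
  to linear growth with slope \<alpha>.\<close>

lemma admissible_state_convolution_exists:
  assumes "\<epsilon> > 0" "admissible_state u \<xi>"
  shows "convolution_exists (g_kernel \<epsilon>) u"
proof -
  from assms(2) obtain \<alpha> where "\<alpha> > 0" and maj: "\<And>y. y > \<xi> \<Longrightarrow> u y \<le> \<alpha> * (y - \<xi>) + 2"
    and sgn: "refined_single_interface u \<xi>"
    by (auto simp: admissible_state_def majorant_property_def)
  have "\<bar>u y\<bar> \<le> \<alpha> * \<bar>y - \<xi>\<bar> + 2" for y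
  proof (cases "y \<le> \<xi>")
    case True
    moreover have "0 \<le> \<alpha> * \<bar>y - \<xi>\<bar>" using \<open>\<alpha> > 0\<close> by simp
    ultimately show ?thesis using sgn unfolding refined_single_interface_def
      by (metis abs_le_iff add.commute add_increasing2 minus_le_iff order_trans zero_le_numeral)
  next
    case False
    then show ?thesis using sgn maj[of y] by (auto simp: refined_single_interface_def)
  qed
  then show ?thesis
    using assms \<open>\<alpha> > 0\<close>
    by (intro convolution_exists_g_kernel_linear_growth[where A = \<alpha> and B = 2 and \<xi> = \<xi>])
      (auto simp: admissible_state_def intro!: borel_measurable_continuous_off_point)
qed

section \<open>Contributions of the two sides of the interface\<close>

locale smoothed_interface =
  fixes \<epsilon> \<xi> :: real and u :: "real \<Rightarrow> real"
  assumes eps: "\<epsilon> > 0"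
    and ex: "convolution_exists (g_kernel \<epsilon>) u"
    and rsi: "refined_single_interface u \<xi>"
begin

lemma integrable_kernel_mult: "integrable lborel (\<lambda>y. g_kernel \<epsilon> (x - y) * u y)"
  using ex by (simp add: convolution_exists_def)

lemma u_left: "y \<le> \<xi> \<Longrightarrow> - 2 \<le> u y" "y \<le> \<xi> \<Longrightarrow> u y \<le> 0"
  and u_right: "y > \<xi> \<Longrightarrow> u y \<ge> 0"
  using rsi by (auto simp: refined_single_interface_def)

text \<open>The comparison holds under the integral. For y \<le> \<xi> the Harnack bound is reversed
  by the factor u(y) \<le> 0; for y > \<xi> the point \<open>z\<close> lies between \<open>x\<close>
  and \<open>y\<close>, where the bound is an equality. The decay to the right of the interface is
  the mirror image.\<close>

lemma smoothed_decay_left: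
  assumes "x \<le> z" "z \<le> \<xi>"
  shows "smoothed \<epsilon> u x \<le> exp ((x - z) / \<epsilon>) * smoothed \<epsilon> u z"
proof -
  have "smoothed \<epsilon> u x \<le> (LINT y|lborel. exp ((x - z) / \<epsilon>) * (g_kernel \<epsilon> (z - y) * u y))"
    unfolding smoothed_def convolution_def
  proof (rule integral_mono)
    fix y
    show "g_kernel \<epsilon> (x - y) * u y \<le> exp ((x - z) / \<epsilon>) * (g_kernel \<epsilon> (z - y) * u y)"
    proof (cases "y \<le> \<xi>")
      case True
      then show ?thesis
        using mult_right_mono_neg[OF g_kernel_shift_le[OF eps, of x z y] u_left(2)[OF True]] assms
        by (simp add: mult.assoc)
    next
      case False
      then show ?thesis
        using g_kernel_shift_eq[of x z y \<epsilon>] assms by simp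
    qed
  qed (use integrable_kernel_mult in auto)
  then show ?thesis by (simp add: smoothed_def convolution_def)
qed

lemma smoothed_decay_right:
  assumes "\<xi> \<le> z" "z \<le> x"
  shows "exp ((z - x) / \<epsilon>) * smoothed \<epsilon> u z \<le> smoothed \<epsilon> u x"
proof -
  have "(LINT y|lborel. exp ((z - x) / \<epsilon>) * (g_kernel \<epsilon> (z - y) * u y)) \<le> smoothed \<epsilon> u x"
    unfolding smoothed_def convolution_def
  proof (rule integral_mono)
    fix y
    show "exp ((z - x) / \<epsilon>) * (g_kernel \<epsilon> (z - y) * u y) \<le> g_kernel \<epsilon> (x - y) * u y"
    proof (cases "y \<le> \<xi>")
      case True
      then show ?thesis
        using g_kernel_shift_eq[of x z y \<epsilon>] assms by simp
    next
      case False
      then show ?thesis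
        using mult_right_mono[OF g_kernel_shift_le[OF eps, of x z y] u_right[of y]] assms False
        by (simp add: mult.assoc)
    qed
  qed (use integrable_kernel_mult in auto)
  then show ?thesis by (simp add: smoothed_def convolution_def)
qed

text \<open>The share of the smoothed value at \<xi> that stems from the nonnegative part of
  \<open>u\<close> right of the interface. It measures how far a left-moving interface can
  travel.\<close>

definition mass :: real where
  "mass = (LINT y|lborel. g_kernel \<epsilon> (\<xi> - y) * u y * indicator {\<xi><..} y)"

lemma integrable_mass: "integrable lborel (\<lambda>y. g_kernel \<epsilon> (x - y) * u y * indicator {\<xi><..} y)"
  by (rule integrable_real_mult_indicator) (auto intro: integrable_kernel_mult)

lemma mass_shift:
  assumes "x \<le> \<xi>"
  shows "(LINT y|lborel. g_kernel \<epsilon> (x - y) * u y * indicator {\<xi><..} y) = exp ((x - \<xi>) / \<epsilon>) * mass"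
proof -
  have "(LINT y|lborel. g_kernel \<epsilon> (x - y) * u y * indicator {\<xi><..} y)
      = (LINT y|lborel. exp ((x - \<xi>) / \<epsilon>) * (g_kernel \<epsilon> (\<xi> - y) * u y * indicator {\<xi><..} y))"
    using assms by (intro Bochner_Integration.integral_cong refl)
      (auto simp: indicator_def g_kernel_shift_eq[of x \<xi>])
  then show ?thesis by (simp add: mass_def)
qed

lemma smoothed_le_mass:
  assumes "x \<le> \<xi>"
  shows "smoothed \<epsilon> u x \<le> exp ((x - \<xi>) / \<epsilon>) * mass"
  unfolding mass_shift[OF assms, symmetric] smoothed_def convolution_def
proof (rule integral_mono)
  fix y
  show "g_kernel \<epsilon> (x - y) * u y \<le> g_kernel \<epsilon> (x - y) * u y * indicator {\<xi><..} y"
    using u_left(2)[of y] g_kernel_nonneg[OF eps, of "x - y"]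
    by (auto simp: indicator_def mult_nonneg_nonpos)
qed (auto intro: integrable_kernel_mult integrable_mass)

text \<open>Left of the interface \<open>u\<close> is replaced by its lower bound -2, whose integral
  against the kernel is known exactly; the right part is kept and shifts exactly. At x = \<xi> this
  becomes mass - 1, which excludes a move to the right.\<close>

lemma smoothed_ge_mass:
  assumes "x \<le> \<xi>"
  shows "- 2 + exp ((x - \<xi>) / \<epsilon>) * (1 + mass) \<le> smoothed \<epsilon> u x"
proof -
  note atMost = has_bochner_integral_g_kernel_atMost'[OF eps assms]
  have "(LINT y|lborel. - 2 * (g_kernel \<epsilon> (x - y) * indicator {..\<xi>} y)
          + g_kernel \<epsilon> (x - y) * u y * indicator {\<xi><..} y) \<le> smoothed \<epsilon> u x"
    unfolding smoothed_def convolution_def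
  proof (rule integral_mono)
    fix y
    show "- 2 * (g_kernel \<epsilon> (x - y) * indicator {..\<xi>} y)
          + g_kernel \<epsilon> (x - y) * u y * indicator {\<xi><..} y \<le> g_kernel \<epsilon> (x - y) * u y"
      using mult_left_mono[OF u_left(1)[of y] g_kernel_nonneg[OF eps, of "x - y"]]
      by (auto simp: indicator_def)
    show "integrable lborel (\<lambda>y. - 2 * (g_kernel \<epsilon> (x - y) * indicator {..\<xi>} y)
          + g_kernel \<epsilon> (x - y) * u y * indicator {\<xi><..} y)"
      using atMost by (intro Bochner_Integration.integrable_add integrable_mult_right integrable_mass)
        (auto simp: has_bochner_integral_iff)
  qed (rule integrable_kernel_mult)
  also have "(LINT y|lborel. - 2 * (g_kernel \<epsilon> (x - y) * indicator {..\<xi>} y)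
          + g_kernel \<epsilon> (x - y) * u y * indicator {\<xi><..} y)
      = - 2 * (1 - exp ((x - \<xi>) / \<epsilon>) / 2) + exp ((x - \<xi>) / \<epsilon>) * mass"
    using atMost integrable_mass
    by (subst Bochner_Integration.integral_add)
      (auto simp: has_bochner_integral_iff mass_shift[OF assms])
  finally show ?thesis by (simp add: algebra_simps)
qed

lemma mass_nonneg: "0 \<le> mass"
  unfolding mass_def using u_right g_kernel_nonneg[OF eps]
  by (intro Bochner_Integration.integral_nonneg) (auto simp: indicator_def)

lemma smoothed_interface_ge: "- 1 \<le> smoothed \<epsilon> u \<xi>"
  using smoothed_ge_mass[of \<xi>] mass_nonneg by simp

section \<open>Unique solvability of the update rule\<close>

lemma smoothed_continuous: "continuous_on A (smoothed \<epsilon> u)"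
  using isCont_smoothed[OF eps ex] by (simp add: continuous_at_imp_continuous_on)

text \<open>Serves twice: to produce a crossing, and to show that the profile stays above 1 between
  the maximal crossing and the old interface.\<close>

lemma left_crossing:
  assumes "x \<le> \<xi>" "smoothed \<epsilon> u x \<le> 1" "smoothed \<epsilon> u \<xi> > 1"
  shows "\<exists>z. x \<le> z \<and> z < \<xi> \<and> smoothed \<epsilon> u z = 1"
  using IVT'[of "smoothed \<epsilon> u" x 1 \<xi>] assms smoothed_continuous
  by (force simp: order.strict_iff_order)

lemma maximal_left_crossing:
  assumes big: "smoothed \<epsilon> u \<xi> > 1"
  shows "\<exists>z<\<xi>. smoothed \<epsilon> u z = 1 \<and> (\<forall>w. w < \<xi> \<and> smoothed \<epsilon> u w = 1 \<longrightarrow> w \<le> z)"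
proof -
  \<comment> \<open>Chosen so that the decay factor exp((x - \<xi>)/\<epsilon>) is the reciprocal of
    the smoothed value at \<xi>; the decay bound at \<open>x\<close> is then exactly 1.\<close>
  define x where "x = \<xi> - \<epsilon> * ln (smoothed \<epsilon> u \<xi>)"
  have "x \<le> \<xi>" using eps big by (simp add: x_def)
  moreover have "smoothed \<epsilon> u x \<le> 1"
    using smoothed_decay_left[of x \<xi>] eps big \<open>x \<le> \<xi>\<close> by (simp add: x_def exp_minus)
  ultimately obtain z0 where z0: "z0 < \<xi>" "smoothed \<epsilon> u z0 = 1"
    using left_crossing[OF _ _ big] by blast
  \<comment> \<open>Crossings left of \<open>z0\<close> cannot be maximal, so a compact set
    suffices. Including \<xi> is harmless, as the smoothed value there exceeds 1.\<close>
  define S where "S = {z0..\<xi>} \<inter> smoothed \<epsilon> u -` {1}"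
  have "compact S"
    unfolding compact_eq_bounded_closed S_def
    by (auto intro: continuous_closed_preimage smoothed_continuous bounded_Int)
  moreover have "z0 \<in> S" using z0 by (simp add: S_def)
  ultimately obtain z where z: "z \<in> S" "\<And>w. w \<in> S \<Longrightarrow> w \<le> z"
    using compact_attains_sup[of S] by auto
  have "z < \<xi>" using z(1) big by (cases "z = \<xi>") (auto simp: S_def)
  moreover have "w \<le> z" if "w < \<xi>" "smoothed \<epsilon> u w = 1" for w
    using z(2)[of w] z(2)[OF \<open>z0 \<in> S\<close>] that by (cases "z0 \<le> w") (auto simp: S_def)
  ultimately show ?thesis using z(1) by (auto simp: S_def)
qed

lemma interface_update_iff:
  "interface_update \<epsilon> u \<xi> \<xi>' \<longleftrightarrow>
     (if smoothed \<epsilon> u \<xi> > 1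
      then \<xi>' < \<xi> \<and> smoothed \<epsilon> u \<xi>' = 1 \<and> (\<forall>z. z < \<xi> \<and> smoothed \<epsilon> u z = 1 \<longrightarrow> z \<le> \<xi>')
      else \<xi>' = \<xi>)"
  using smoothed_interface_ge by (auto simp: interface_update_def)

lemma ex1_interface_update: "\<exists>!\<xi>'. interface_update \<epsilon> u \<xi> \<xi>'"
proof (cases "smoothed \<epsilon> u \<xi> > 1")
  case True
  then show ?thesis
    using maximal_left_crossing unfolding interface_update_iff
    by (auto intro: order.antisym)
qed (simp add: interface_update_iff)

section \<open>Sign and lower bounds for the new state\<close>

lemma refined_single_interface_step:
  assumes upd: "interface_update \<epsilon> u \<xi> \<xi>'"
  shows "refined_single_interface (\<lambda>x. smoothed \<epsilon> u x + s_kernel \<epsilon> (x - \<xi>')) \<xi>'"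
proof -
  have le: "\<xi>' \<le> \<xi>" and le1: "smoothed \<epsilon> u \<xi>' \<le> 1"
    using upd by (auto simp: interface_update_iff split: if_splits)
  \<comment> \<open>If the interface moves, the smoothed value 1 at \<open>\<xi>'\<close> is at most
    \<open>mass\<close> times the decay factor from \<xi> to \<open>\<xi>'\<close>; if it stands,
    the left side is 1.\<close>
  have mass: "exp ((\<xi> - \<xi>') / \<epsilon>) \<le> 1 + mass"
  proof (cases "smoothed \<epsilon> u \<xi> > 1")
    case True
    then have "1 \<le> exp ((\<xi>' - \<xi>) / \<epsilon>) * mass"
      using upd smoothed_le_mass[OF le] by (simp add: interface_update_iff)
    then have "exp ((\<xi> - \<xi>') / \<epsilon>) * 1 \<le> exp ((\<xi> - \<xi>') / \<epsilon>) * (exp ((\<xi>' - \<xi>) / \<epsilon>) * mass)"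
      by (intro mult_left_mono) auto
    also have "\<dots> = mass"
      by (simp add: mult.assoc[symmetric] exp_add[symmetric] add_divide_distrib[symmetric])
    finally show ?thesis by simp
  next
    case False
    then show ?thesis using upd mass_nonneg by (simp add: interface_update_iff)
  qed
  \<comment> \<open>The bound on \<open>mass\<close> makes the positive contribution large enough to
    pay for the subtracted exponential, which is now centred at \<open>\<xi>'\<close>.\<close>
  have lo: "- 2 \<le> smoothed \<epsilon> u x - exp ((x - \<xi>') / \<epsilon>)" if "x \<le> \<xi>'" for x
  proof -
    have "exp ((x - \<xi>') / \<epsilon>) = exp ((x - \<xi>) / \<epsilon>) * exp ((\<xi> - \<xi>') / \<epsilon>)"
      by (simp add: exp_add[symmetric] add_divide_distrib[symmetric])
    also have "\<dots> \<le> exp ((x - \<xi>) / \<epsilon>) * (1 + mass)"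
      using mass by (intro mult_left_mono) auto
    finally show ?thesis using smoothed_ge_mass[of x] that le by linarith
  qed
  have up: "smoothed \<epsilon> u x \<le> exp ((x - \<xi>') / \<epsilon>)" if "x \<le> \<xi>'" for x
    using smoothed_decay_left[OF that le] mult_left_le[OF le1, of "exp ((x - \<xi>') / \<epsilon>)"]
    by (meson exp_ge_zero order_trans)
  have pos: "- exp ((\<xi>' - x) / \<epsilon>) \<le> smoothed \<epsilon> u x" if "x > \<xi>'" for x
  proof (cases "smoothed \<epsilon> u \<xi> > 1")
    case True
    have "0 \<le> smoothed \<epsilon> u x"
    proof (cases "x \<le> \<xi>")
      case le: True
      \<comment> \<open>A value of at most 1 here would force, by the intermediate value theorem, a
        crossing in [x, \<xi>), to the right of the maximal one.\<close>
      then have "\<not> smoothed \<epsilon> u x \<le> 1"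
        using left_crossing[OF le _ True] upd True that by (force simp: interface_update_iff)
      then show ?thesis by simp
    next
      case False
      then have "exp ((\<xi> - x) / \<epsilon>) * smoothed \<epsilon> u \<xi> \<le> smoothed \<epsilon> u x"
        by (intro smoothed_decay_right) auto
      moreover have "0 \<le> exp ((\<xi> - x) / \<epsilon>) * smoothed \<epsilon> u \<xi>"
        using True by simp
      ultimately show ?thesis by linarith
    qed
    then show ?thesis using exp_gt_zero[of "(\<xi>' - x) / \<epsilon>"] by linarith
  next
    case False
    then have "\<xi>' = \<xi>" using upd by (simp add: interface_update_iff)
    \<comment> \<open>Without a move, the decay to the right starts from a value of at least -1 at
      \<xi>, which is exactly what the jump kernel compensates.\<close>
    then show ?thesis
      using smoothed_decay_right[of \<xi> x] that
        mult_left_mono[OF smoothed_interface_ge, of "exp ((\<xi> - x) / \<epsilon>)"] by simp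
  qed
  show ?thesis
    unfolding refined_single_interface_def s_kernel_def using lo up pos by force
qed

end

theorem lemma3:
  fixes \<epsilon> \<xi> :: real and u :: "real \<Rightarrow> real"
  assumes "\<epsilon> > 0"
    and "admissible_state u \<xi>"
  shows "convolution_exists (g_kernel \<epsilon>) u \<and>
         (\<exists>!\<xi>'. interface_update \<epsilon> u \<xi> \<xi>') \<and>
         (\<forall>u' \<xi>'. iteration_step \<epsilon> (u, \<xi>) (u', \<xi>') \<longrightarrow> refined_single_interface u' \<xi>')"
proof -
  interpret smoothed_interface \<epsilon> \<xi> u
    using assms admissible_state_convolution_exists
    by unfold_locales (auto simp: admissible_state_def)
  show ?thesis
    using ex ex1_interface_update refined_single_interface_step by (auto simp: iteration_step_def)
qed

end
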